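(* For dual bin packing, Unfair-First-Fit has online bounded ratio $0$.
   Context: Dual bin packing: there are $n$ bins of capacity $1$; items with sizes in $(0,1]$ arrive online and each must be irrevocably either rejected or placed in a bin with enough remaining capacity; the goal is to maximize the number of packed items. Unfair-First-Fit packs items using First-Fit (first bin in a fixed order where the item fits), except that whenever an item larger than $\frac12$ arrives, it rejects the item unless rejecting it would bring the number of items it has accepted below $\frac23$ of the number of items accepted by an optimal offline solution on the prefix of items given so far. For a deterministic online algorithm $A$, $\textsc{Opt}_A$ denotes an offline algorithm that is optimal among offline algorithms whose packing of any input $I$ satisfies, for every prefix $I'$ of $I$, that it packs at least $A(I')$ items of $I'$; the (asymptotic) online bounded ratio of $A$ is the supremum of all $c$ for which there is a constant $\alpha$ with $A(I)\ge c\,\textsc{Opt}_A(I)-\alpha$ for all input sequences $I$.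
   Formalization: The claim is proved for every fixed number of bins n ≥ 2 (the constant may depend on n); for n = 1 it fails, since there the optimal online-bounded packing gains at most one item over Unfair-First-Fit and the ratio is 1. *)

theory Defs
  imports "HOL-Library.Extended_Real"
begin

text \<open>
  An input sequence is the list of its item sizes. A packing of it is a list of the same length
  whose \<open>i\<close>-th entry is \<open>Some b\<close> if item \<open>i\<close> is placed in bin \<open>b\<close>, and \<open>None\<close> if it is rejected.
  The \<open>n\<close> bins are \<open>0, ..., n - 1\<close>.
\<close>

type_synonym packing = "(nat option) list"

definition valid_input :: "real list \<Rightarrow> bool" where
  "valid_input xs \<longleftrightarrow> set xs \<subseteq> {0<..1}"

definition load :: "real list \<Rightarrow> packing \<Rightarrow> nat \<Rightarrow> real" where
  "load xs p b = (\<Sum>i | i < length xs \<and> p ! i = Some b. xs ! i)"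

definition packed :: "packing \<Rightarrow> nat" where
  "packed p = length (filter (\<lambda>d. d \<noteq> None) p)"

definition feasible :: "nat \<Rightarrow> real list \<Rightarrow> packing \<Rightarrow> bool" where
  "feasible n xs p \<longleftrightarrow>
     length p = length xs \<and> set p \<subseteq> insert None (Some ` {..<n}) \<and> (\<forall>b<n. load xs p b \<le> 1)"

definition opt :: "nat \<Rightarrow> real list \<Rightarrow> nat" where
  "opt n xs = Max {packed p | p. feasible n xs p}"

text \<open>
  A deterministic online algorithm maps the items seen so far, the decisions made on them and the
  new item to the decision on the new item.
\<close>

type_synonym online_rule = "real list \<Rightarrow> packing \<Rightarrow> real \<Rightarrow> nat option"

fun run_from :: "online_rule \<Rightarrow> real list \<Rightarrow> packing \<Rightarrow> real list \<Rightarrow> packing" where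
  "run_from r seen p [] = p"
| "run_from r seen p (x # xs) = run_from r (seen @ [x]) (p @ [r seen p x]) xs"

definition run :: "online_rule \<Rightarrow> real list \<Rightarrow> packing" where
  "run r xs = run_from r [] [] xs"

definition first_fit :: "nat \<Rightarrow> online_rule" where
  "first_fit n seen p x =
     (if \<exists>b<n. load seen p b + x \<le> 1
      then Some (LEAST b. b < n \<and> load seen p b + x \<le> 1)
      else None)"

text \<open>
  Rejecting \<open>x\<close> leaves \<open>packed p\<close> accepted items, and the prefix given so far includes \<open>x\<close>.
\<close>

definition unfair_first_fit :: "nat \<Rightarrow> online_rule" where
  "unfair_first_fit n seen p x =
     (if x > 1/2 \<and> \<not> real (packed p) < 2/3 * real (opt n (seen @ [x]))
      then None
      else first_fit n seen p x)"

text \<open>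
  The offline packings of \<open>xs\<close> that, on every prefix of \<open>xs\<close>, pack at least as many items as the
  online algorithm packs when it is given that prefix.
\<close>

definition online_bounded :: "nat \<Rightarrow> online_rule \<Rightarrow> real list \<Rightarrow> packing \<Rightarrow> bool" where
  "online_bounded n r xs p \<longleftrightarrow>
     feasible n xs p \<and> (\<forall>k\<le>length xs. packed (run r (take k xs)) \<le> packed (take k p))"

definition opt_bounded :: "nat \<Rightarrow> online_rule \<Rightarrow> real list \<Rightarrow> nat" where
  "opt_bounded n r xs = Max {packed p | p. online_bounded n r xs p}"

definition online_bounded_ratio :: "nat \<Rightarrow> online_rule \<Rightarrow> ereal" where
  "online_bounded_ratio n r =
     (SUP c \<in> {c :: real. \<exists>\<alpha> :: real. \<forall>xs. valid_input xs \<longrightarrow>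
                 real (packed (run r xs)) \<ge> c * real (opt_bounded n r xs) - \<alpha>}. ereal c)"

text \<open>
  The maxima above are over finite sets, and the set in \<^const>\<open>opt_bounded\<close> is nonempty for
  Unfair-First-Fit because its own packing belongs to it.
\<close>

lemma finite_feasible: "finite {p. feasible n xs p}"
  by (rule finite_subset[OF _ finite_lists_length_eq[of "insert None (Some ` {..<n})" "length xs"]])
    (auto simp: feasible_def)

lemma run_from_append:
  "length p = length seen \<Longrightarrow>
   run_from r seen p (xs @ ys) = run_from r (seen @ xs) (run_from r seen p xs) ys"
  by (induction xs arbitrary: seen p) auto

lemma run_Nil [simp]: "run r [] = []"
  by (simp add: run_def)

lemma run_snoc: "run r (xs @ [x]) = run r xs @ [r xs (run r xs) x]"
  by (simp add: run_def run_from_append)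

lemma length_run [simp]: "length (run r xs) = length xs"
  by (induction xs rule: rev_induct) (auto simp: run_snoc)

lemma take_run: "k \<le> length xs \<Longrightarrow> take k (run r xs) = run r (take k xs)"
  by (induction xs rule: rev_induct) (auto simp: run_snoc le_Suc_eq)

lemma load_snoc:
  assumes "length p = length xs"
  shows "load (xs @ [x]) (p @ [d]) b = load xs p b + (if d = Some b then x else 0)"
proof -
  have "{i. i < length (xs @ [x]) \<and> (p @ [d]) ! i = Some b} =
        {i. i < length xs \<and> p ! i = Some b} \<union> (if d = Some b then {length xs} else {})"
    using assms by (auto simp: nth_append less_Suc_eq split: if_splits)
  then show ?thesis
    unfolding load_def by (auto simp: sum.union_disjoint nth_append intro!: sum.cong)
qed

lemma feasible_run_unfair_first_fit: "feasible n xs (run (unfair_first_fit n) xs)"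
proof (induction xs rule: rev_induct)
  case Nil
  then show ?case by (simp add: feasible_def load_def)
next
  case (snoc x xs)
  define p where "p = run (unfair_first_fit n) xs"
  define d where "d = unfair_first_fit n xs p x"
  have d: "b < n \<and> load xs p b + x \<le> 1" if "d = Some b" for b
  proof -
    have "\<exists>b<n. load xs p b + x \<le> 1" "b = (LEAST b. b < n \<and> load xs p b + x \<le> 1)"
      using that by (auto simp: d_def unfair_first_fit_def first_fit_def split: if_splits)
    then show ?thesis by (metis (mono_tags, lifting) LeastI)
  qed
  have "feasible n xs p" using snoc p_def by simp
  then show ?case
    using d by (cases d) (auto simp: run_snoc feasible_def load_snoc simp flip: p_def d_def)
qed

lemma online_bounded_run_unfair_first_fit:
  "online_bounded n (unfair_first_fit n) xs (run (unfair_first_fit n) xs)"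
  by (simp add: online_bounded_def feasible_run_unfair_first_fit take_run)

end

theory Submission
  imports Defs
begin

text \<open>
  The adversary starts with items of sizes 1/8, 1/8, 5/8, 3/4. Unfair-First-Fit rejects the item of
  size 5/8, since 2 accepted items out of 3 are enough, but has to accept the item of size 3/4,
  since 2 out of 4 are not; this fills its first bin completely. An offline packing may accept 5/8
  and reject 3/4 instead, without ever falling behind, and keeps a gap of 1/8 in its first bin.
  Both then fill the other bins with items of size 1/2. Finally \<open>N\<close> items of size 1/(8\<open>N\<close>) arrive,
  which Unfair-First-Fit must all reject, while the offline packing accepts all of them.
\<close>

lemma packed_simps [simp]:
  "packed [] = 0"
  "packed (d # p) = (if d = None then 0 else 1) + packed p"
  "packed (p @ q) = packed p + packed q"
  by (auto simp: packed_def)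

lemma packed_replicate_None [simp]: "packed (replicate k None) = 0"
  by (simp add: packed_def)

lemma packed_replicate_Some [simp]: "packed (replicate k (Some b)) = k"
  by (simp add: packed_def)

lemma packed_le_length: "packed p \<le> length p"
  by (simp add: packed_def)

lemma load_Nil [simp]: "load [] p b = 0"
  by (simp add: load_def)

lemma load_append:
  assumes "length p = length xs" "length q = length ys"
  shows "load (xs @ ys) (p @ q) b = load xs p b + load ys q b"
  using assms(2)
proof (induction q ys rule: rev_induct2)
  case (4 y ys d q)
  then show ?case
    using assms(1) by (simp add: load_snoc flip: append_assoc)
qed simp_all

lemma load_Cons:
  assumes "length p = length xs"
  shows "load (x # xs) (d # p) b = (if d = Some b then x else 0) + load xs p b"
  using load_append[of "[d]" "[x]" p xs b] load_snoc[of "[]" "[]" x d b] assms by simp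

lemma load_replicate:
  "load (replicate k x) (replicate k d) b = (if d = Some b then real k * x else 0)"
  by (induction k) (auto simp: load_Cons algebra_simps)

lemma finite_packed_feasible: "finite {packed p | p. feasible n xs p}"
  by (simp add: finite_feasible setcompr_eq_image)

lemma packed_le_opt: "feasible n xs p \<Longrightarrow> packed p \<le> opt n xs"
  unfolding opt_def using finite_packed_feasible by (intro Max_ge) auto

lemma opt_le_length: "opt n xs \<le> length xs"
proof -
  \<comment> \<open>\<open>Max_le_iff\<close> needs a nonempty set; the online packing is a feasible
    member.\<close>
  have "feasible n xs (run (unfair_first_fit n) xs)"
    by (rule feasible_run_unfair_first_fit)
  then show ?thesis
    unfolding opt_def using finite_packed_feasible packed_le_length
    by (subst Max_le_iff) (auto simp: feasible_def, metis)
qed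

lemma packed_le_opt_bounded: "online_bounded n r xs p \<Longrightarrow> packed p \<le> opt_bounded n r xs"
  unfolding opt_bounded_def
  by (intro Max_ge finite_subset[OF _ finite_packed_feasible[of n xs]])
    (auto simp: online_bounded_def)

lemma first_fit_eq_Some:
  assumes "b < n" "load seen p b + x \<le> 1" "\<And>b'. b' < b \<Longrightarrow> load seen p b' + x > 1"
  shows "first_fit n seen p x = Some b"
proof -
  have "(LEAST b. b < n \<and> load seen p b + x \<le> 1) = b"
    using assms by (intro Least_equality) (auto simp: not_less[symmetric])
  then show ?thesis
    using assms by (auto simp: first_fit_def)
qed

definition prelude :: "real list" where
  "prelude = [1/8, 1/8, 5/8, 3/4]"

lemma run_prelude:
  assumes "n \<ge> 2"
  shows "run (unfair_first_fit n) prelude = [Some 0, Some 0, None, Some 0]"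
proof -
  let ?r = "unfair_first_fit n"
  have 1: "run ?r [1/8] = [Some 0]"
    using assms run_snoc[of ?r "[]" "1/8"]
    by (simp add: unfair_first_fit_def first_fit_eq_Some)
  have 2: "run ?r [1/8, 1/8] = [Some 0, Some 0]"
    using assms run_snoc[of ?r "[1/8]" "1/8"]
    by (simp add: 1 unfair_first_fit_def first_fit_eq_Some load_Cons)
  \<comment> \<open>2 is not strictly below 2/3 * 3, so the rule rejects 5/8.\<close>
  have "opt n [1/8, 1/8, 5/8] \<le> 3"
    using opt_le_length[of n "[1/8, 1/8, 5/8]"] by simp
  then have 3: "run ?r [1/8, 1/8, 5/8] = [Some 0, Some 0, None]"
    using run_snoc[of ?r "[1/8, 1/8]" "5/8"]
    by (simp add: 2 unfair_first_fit_def)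
  \<comment> \<open>The second bin takes 3/4, so all four items can be packed. Since 2 < 8/3, the
    online algorithm must now pass 3/4 to First-Fit, and 1/8 + 1/8 + 3/4 = 1.\<close>
  have "feasible n prelude [Some 0, Some 0, Some 0, Some 1]"
    using assms by (simp add: feasible_def prelude_def load_Cons)
  from packed_le_opt[OF this] have "opt n prelude \<ge> 4"
    by simp
  then show ?thesis
    using assms run_snoc[of ?r "[1/8, 1/8, 5/8]" "3/4"]
    by (simp add: 3 prelude_def unfair_first_fit_def first_fit_eq_Some load_Cons)
qed

text \<open>The items of size 1/2 go to bins 1, 1, 2, 2, and so on. Bin 0 is skipped because both
  the online and the offline packing have less than 1/2 free there, so the two can share this
  list.\<close>

definition pairs :: "nat \<Rightarrow> packing" where
  "pairs m = map (\<lambda>j. Some ((j + 2) div 2)) [0..<m]"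

lemma length_pairs [simp]: "length (pairs m) = m"
  by (simp add: pairs_def)

lemma packed_pairs [simp]: "packed (pairs m) = m"
  by (simp add: pairs_def packed_def filter_map o_def)

lemma pairs_Suc: "pairs (Suc m) = pairs m @ [Some ((m + 2) div 2)]"
  by (simp add: pairs_def)

text \<open>Bin b > 0 receives exactly the items with index 2b - 2 and 2b - 1. Truncated subtraction
  yields 0 before the first of them has arrived.\<close>

lemma load_pairs:
  "load (replicate m (1/2)) (pairs m) b =
     (if b = 0 then 0 else real (min 2 (m + 2 - 2 * b)) / 2)"
proof (induction m)
  case 0
  then show ?case by simp
next
  case (Suc m)
  have "load (replicate (Suc m) (1/2)) (pairs (Suc m)) b =
      load (replicate m (1/2)) (pairs m) b + (if (m + 2) div 2 = b then 1/2 else 0)"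
    unfolding pairs_Suc replicate_Suc
    by (simp add: load_snoc replicate_append_same[symmetric])
  also have "\<dots> = (if b = 0 then 0 else real (min 2 (Suc m + 2 - 2 * b)) / 2)"
  proof -
    \<comment> \<open>Item m enters bin b as its second item if 2b = m + 1 and as its first if 2b =
      m + 2; otherwise the load of b is unchanged.\<close>
    consider "b = 0" | "b > 0" "2 * b \<le> m" | "2 * b = m + 1" | "2 * b = m + 2" | "2 * b > m + 2"
      by linarith
    then show ?thesis
    proof cases
      case 3
      then have "(m + 2) div 2 = b" "m + 2 - 2 * b = 1" "Suc m + 2 - 2 * b = 2" "b \<noteq> 0"
        by presburger+
      then show ?thesis by (simp add: Suc)
    next
      case 4
      then have "(m + 2) div 2 = b" "m + 2 - 2 * b = 0" "Suc m + 2 - 2 * b = 1" "b \<noteq> 0"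
        by presburger+
      then show ?thesis by (simp add: Suc)
    qed (use Suc in auto)
  qed
  finally show ?case .
qed

lemma run_halves:
  assumes "n \<ge> 2" "m \<le> 2 * (n - 1)"
  shows "run (unfair_first_fit n) (prelude @ replicate m (1/2)) =
    [Some 0, Some 0, None, Some 0] @ pairs m"
  using assms(2)
proof (induction m)
  case 0
  then show ?case using assms(1) by (simp add: run_prelude pairs_def)
next
  case (Suc m)
  let ?xs = "prelude @ replicate m (1/2)" and ?p = "[Some 0, Some 0, None, Some 0] @ pairs m"
  \<comment> \<open>The formula covers b = 0 as well: it gives 1 there, the load left by
    \<open>prelude\<close>.\<close>
  have load: "load ?xs ?p b = real (min 2 (m + 2 - 2 * b)) / 2" for b
    by (subst load_append) (simp_all add: prelude_def load_Cons load_pairs)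
  have "first_fit n ?xs ?p (1/2) = Some ((m + 2) div 2)"
  proof (rule first_fit_eq_Some)
    show "(m + 2) div 2 < n"
      using Suc.prems by linarith
    show "load ?xs ?p ((m + 2) div 2) + 1/2 \<le> 1"
    proof -
      have "min 2 (m + 2 - 2 * ((m + 2) div 2)) \<le> 1" by presburger
      then have "real (min 2 (m + 2 - 2 * ((m + 2) div 2))) \<le> 1" by linarith
      then show ?thesis unfolding load by linarith
    qed
    show "load ?xs ?p b + 1/2 > 1" if "b < (m + 2) div 2" for b
    proof -
      have "m + 2 - 2 * b \<ge> 2" using that by presburger
      then show ?thesis unfolding load by simp
    qed
  qed
  \<comment> \<open>Size 1/2 is not above the threshold, so plain First-Fit decides.\<close>
  then have "unfair_first_fit n ?xs ?p (1/2) = Some ((m + 2) div 2)"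
    by (simp add: unfair_first_fit_def)
  then show ?case
    using Suc run_snoc[of "unfair_first_fit n" ?xs "1/2"]
    by (simp add: pairs_Suc replicate_append_same)
qed

definition adversary :: "nat \<Rightarrow> nat \<Rightarrow> real list" where
  "adversary n N =
     (prelude @ replicate (2 * (n - 1)) (1/2)) @ replicate N (1 / (8 * real N))"

lemma run_adversary:
  assumes "n \<ge> 2" "N > 0"
  shows "run (unfair_first_fit n) (adversary n N) =
    ([Some 0, Some 0, None, Some 0] @ pairs (2 * (n - 1))) @ replicate N None"
proof -
  let ?xs = "prelude @ replicate (2 * (n - 1)) (1/2)"
    and ?p = "[Some 0, Some 0, None, Some 0] @ pairs (2 * (n - 1))"
    and ?e = "1 / (8 * real N)"
  have e: "?e > 0" "?e \<le> 1/2"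
    using assms(2) by (auto simp: field_simps)
  \<comment> \<open>Bin 0 is full after \<open>prelude\<close>, and the 2(n - 1) halves fill the n -
    1 others, so no positive size fits any more.\<close>
  have full: "load ?xs ?p b = 1" if "b < n" for b
  proof -
    have "min 2 (2 * (n - 1) + 2 - 2 * b) = 2" using that by linarith
    then show ?thesis
      by (subst load_append) (simp_all add: prelude_def load_Cons load_pairs)
  qed
  have "run (unfair_first_fit n) (?xs @ replicate k ?e) = ?p @ replicate k None" for k
  proof (induction k)
    case 0
    then show ?case using run_halves[OF assms(1) order_refl] by simp
  next
    case (Suc k)
    have "load (?xs @ replicate k ?e) (?p @ replicate k None) b = 1" if "b < n" for b
      using full[OF that] by (subst load_append) (simp_all add: load_replicate prelude_def)
    then have "unfair_first_fit n (?xs @ replicate k ?e) (?p @ replicate k None) ?e = None"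
      using e by (auto simp: unfair_first_fit_def first_fit_def simp del: append_assoc)
    then show ?case
      using Suc run_snoc[of "unfair_first_fit n" "?xs @ replicate k ?e" ?e]
      by (simp add: replicate_append_same)
  qed
  then show ?thesis
    unfolding adversary_def by simp
qed

text \<open>The offline packing is one item ahead after 5/8 and level again after 3/4. The halves
  keep it level, and afterwards only the offline packing gains.\<close>

lemma online_bounded_adversary:
  assumes "n \<ge> 2" "N > 0"
  shows "online_bounded n (unfair_first_fit n) (adversary n N)
    ([Some 0, Some 0, Some 0, None] @ pairs (2 * (n - 1)) @ replicate N (Some 0))"
    (is "online_bounded _ _ _ ?p")
  unfolding online_bounded_def
proof (intro conjI allI impI)
  \<comment> \<open>In bin 0 the small items total 1/8, exactly the gap above 1/8 + 1/8 +
    5/8.\<close>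
  have "load (adversary n N) ?p b \<le> 1" if "b < n" for b
    using assms
    by (simp add: adversary_def prelude_def load_append load_Cons load_pairs load_replicate)
  moreover have "set (pairs (2 * (n - 1))) \<subseteq> Some ` {..<n}"
    by (auto simp: pairs_def)
  ultimately show "feasible n (adversary n N) ?p"
    using assms by (auto simp: feasible_def adversary_def prelude_def)
next
  fix k assume k: "k \<le> length (adversary n N)"
  have init: "packed (take k [Some 0, Some 0, None, Some 0]) \<le>
      packed (take k [Some 0, Some 0, Some 0, None])"
    by (auto simp: take_Cons split: nat.splits)
  have "packed (run (unfair_first_fit n) (take k (adversary n N))) =
      packed (take k (run (unfair_first_fit n) (adversary n N)))"
    using k by (simp add: take_run)
  also have "\<dots> \<le> packed (take k ?p)"
    unfolding run_adversary[OF assms] using init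
    by (simp only: take_append packed_simps take_replicate append_assoc length_append)
      (simp add: take_append)
  finally show "packed (run (unfair_first_fit n) (take k (adversary n N))) \<le> packed (take k ?p)" .
qed

lemma online_bounded_ratio_witness_nonpos:
  assumes "n \<ge> 2"
    and c: "\<And>xs. valid_input xs \<Longrightarrow>
      real (packed (run (unfair_first_fit n) xs)) \<ge>
        c * real (opt_bounded n (unfair_first_fit n) xs) - \<alpha>"
  shows "c \<le> 0"
proof (rule ccontr)
  assume "\<not> c \<le> 0"
  then have "c > 0" by simp
  \<comment> \<open>The online count 3 + 2(n - 1) = 2n + 1 does not depend on the number of small
    items, so enough of them defeat any c > 0. Taking \<open>Suc M\<close> of them keeps that number
    positive.\<close>
  obtain M where M: "(real (2 * n + 1) + \<alpha>) / c < real M"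
    using reals_Archimedean2 by blast
  let ?N = "Suc M"
  let ?xs = "adversary n ?N"
  have "valid_input ?xs"
    by (auto simp: valid_input_def adversary_def prelude_def divide_le_eq)
  have "packed (run (unfair_first_fit n) ?xs) = 2 * n + 1"
    using assms(1) by (simp add: run_adversary)
  moreover have "?N \<le> opt_bounded n (unfair_first_fit n) ?xs"
    using packed_le_opt_bounded[OF online_bounded_adversary[of n ?N]] assms(1) by simp
  then have "c * real ?N \<le> c * real (opt_bounded n (unfair_first_fit n) ?xs)"
    using \<open>c > 0\<close> by (intro mult_left_mono) auto
  ultimately have "c * real ?N \<le> real (2 * n + 1) + \<alpha>"
    using c[OF \<open>valid_input ?xs\<close>] by linarith
  then have "real ?N \<le> (real (2 * n + 1) + \<alpha>) / c"
    using \<open>c > 0\<close> by (simp add: field_simps)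
  with M show False by simp
qed

theorem theorem12:
  fixes n :: nat
  assumes "n \<ge> 2"
  shows "online_bounded_ratio n (unfair_first_fit n) = 0"
proof (rule antisym)
  show "online_bounded_ratio n (unfair_first_fit n) \<le> 0"
    unfolding online_bounded_ratio_def
    using online_bounded_ratio_witness_nonpos[OF assms] by (intro SUP_least) (simp, blast)
  \<comment> \<open>c = 0 is admissible with \<alpha> = 0, as counts are nonnegative.\<close>
  have "ereal 0 \<le> online_bounded_ratio n (unfair_first_fit n)"
    unfolding online_bounded_ratio_def by (rule SUP_upper) (auto intro: exI[of _ 0])
  then show "0 \<le> online_bounded_ratio n (unfair_first_fit n)"
    by (simp add: zero_ereal_def)
qed

end
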